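(* Let $\Sigma$ be an online sequence of incremental reachability operations (on a directed acyclic graph $G$ of width $k=O(1)$, represented as $k$ chains of length at most $n$ with extra edges between them). The data structure $\mathsf{DS}$, described in the context, correctly handles $\Sigma$ and spends (i) $O(n)$ preprocessing time and (ii) $O(\log n)$ time per operation.
   Context: **Graph representation.** $G=(V,E)$ is a DAG of width $k$ (the width is the maximum size of an antichain of the partial order given by reachability), with $k=O(1)$. It is given as $k$ totally ordered chains with extra edges between them: $V\subseteq[k]\times[n]$, where $\langle i,j\rangle$ is the $j$-th node of the $i$-th chain, and consecutive nodes $\langle i,j\rangle,\langle i,j+1\rangle\in V$ are joined by an edge from $\langle i,j\rangle$ to $\langle i,j+1\rangle$. The cross-chain edges are given by arrays $\mathsf{Out}_{i_1}^{i_2}$, for $i_1\ne i_2$ in $[k]$, of length $n$ with entries in $[n]\cup\{\infty\}$, where $\mathsf{Out}_{i_1}^{i_2}[j_1]=j_2\in[n]$ iff $(\langle i_1,j_1\rangle,\langle i_2,j_2\rangle)\in E$. Node $\langle i,j_1\rangle$ is *higher* than $\langle i,j_2\rangle$ (and the latter *lower* than the former) if $j_1\le j_2$. Write $u\rightsquigarrow v$ if $v$ is reachable from $u$. **Incremental reachability operations.** The operations arrive online; answers must take into account all preceding insertions: 1. $\mathsf{insert}(u,v)$, where $v\not\rightsquigarrow u$: inserts the edge $(u,v)$ in $G$. 2. $\mathsf{query}(u,v)$: returns True iff $u\rightsquigarrow v$. 3. $\mathsf{successor}(u,i)$: returns the highest successor of $u$ in the $i$-th chain. 4. $\mathsf{predecessor}(u,i)$: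 returns the lowest predecessor of $u$ in the $i$-th chain. **Fenwick trees.** For an integer array $A$ of length $n$, a Fenwick tree supports, after $O(n)$ preprocessing time and in $O(\log n)$ time per operation: $\mathsf{update}(i,x)$, which sets $A[i]=x$; $\min(i)$, which returns $\min_{i\le j\le n}A[j]$; and $\mathsf{argleq}(i)$, which returns $\max\{j: A[j]\le i\}$. **The data structure $\mathsf{DS}$.** - *Initialization.* For each $i_1\ne i_2$ in $[k]$, a Fenwick tree $F_{i_1}^{i_2}$ is initialized with the array $\mathsf{Out}_{i_1}^{i_2}$. It stores forward reachability information from the $i_1$-th chain to the $i_2$-th chain; the invariant to be maintained is that $F_{i_1}^{i_2}.\min(j_1)=j_2$ iff $\langle i_2,j_2\rangle$ is the highest node of the $i_2$-th chain reachable from $\langle i_1,j_1\rangle$. - $\mathsf{successor}(\langle i_1,j_1\rangle,i)$ returns $F_{i_1}^{i}.\min(j_1)$, and $\mathsf{predecessor}(\langle i_1,j_1\rangle,i)$ returns $F_{i}^{i_1}.\mathsf{argleq}(j_1)$ (for $i=i_1$ both return $j_1$). - $\mathsf{insert}(\langle i_1,j_1\rangle,\langle i_2,j_2\rangle)$: for each $i_1'\in[k]$ and each $i_2'\in[k]$, let $j_1'=\mathsf{predecessor}(\langle i_1,j_1\rangle,i_1')$ and $j_2'=\mathsf{successor}(\langle i_2,j_2\rangle,i_2')$, and perform $F_{i_1'}^{i_2'}.\mathsf{update}(j_1',j_2')$ (this concerns only pairs $i_1'\ne i_2'$ for which $j_1',j_2'$ exist). - $\mathsf{query}(\langle i_1,j_1\rangle,\langle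 i_2,j_2\rangle)$: let $j_2'=\mathsf{successor}(\langle i_1,j_1\rangle,i_2)$; return True if $j_2'\le j_2$, and False otherwise. The width $k$ is treated as a constant in the $O$-notation.
   Formalization: As written the claim is false; here insert performs F.update(j1',j2') only if j2' is smaller than F.min(j1') (else a better entry is overwritten), and the initial arrays Out are assumed to satisfy the stated invariant (else paths through third chains are missed). *)

theory Defs
  imports Complex_Main "HOL-Library.Extended_Nat" "HOL-Library.Landau_Symbols"
    "HOL-Library.Monad_Syntax"
begin

section \<open>Chain representation of a DAG\<close>

text \<open>The node \<open>(i, j)\<close> is the \<open>j\<close>-th node of the \<open>i\<close>-th chain. Chains, and positions in
  chains and arrays, are counted from 1; lists are 0-based, so position \<open>j\<close> of an array \<open>A\<close>
  is \<open>A ! (j - 1)\<close>.\<close>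

type_synonym node = "nat \<times> nat"

abbreviation reaches :: "node rel \<Rightarrow> node \<Rightarrow> node \<Rightarrow> bool" where
  "reaches E u v \<equiv> (u, v) \<in> E\<^sup>*"

definition antichain :: "node rel \<Rightarrow> node set \<Rightarrow> bool" where
  "antichain E A \<longleftrightarrow> (\<forall>u\<in>A. \<forall>v\<in>A. u \<noteq> v \<longrightarrow> \<not> reaches E u v)"

definition width :: "node set \<Rightarrow> node rel \<Rightarrow> nat" where
  "width V E = Max (card ` {A. A \<subseteq> V \<and> antichain E A})"

text \<open>The third conjunct says that chain \<open>i\<close> occupies an initial segment of positions, as it
  must if \<open>(i, j)\<close> is the \<open>j\<close>-th node of its chain.\<close>

definition chain_representation ::
  "nat \<Rightarrow> nat \<Rightarrow> node set \<Rightarrow> node rel \<Rightarrow> (nat \<times> nat \<Rightarrow> enat list) \<Rightarrow> bool" where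
  "chain_representation k n V E Out \<longleftrightarrow>
     V \<subseteq> {1..k} \<times> {1..n} \<and> E \<subseteq> V \<times> V \<and>
     (\<forall>i j j'. (i, j) \<in> V \<and> 1 \<le> j' \<and> j' \<le> j \<longrightarrow> (i, j') \<in> V) \<and>
     (\<forall>i j. (i, j) \<in> V \<and> (i, Suc j) \<in> V \<longrightarrow> ((i, j), (i, Suc j)) \<in> E) \<and>
     (\<forall>i1\<in>{1..k}. \<forall>i2\<in>{1..k}. i1 \<noteq> i2 \<longrightarrow>
        length (Out (i1, i2)) = n \<and>
        set (Out (i1, i2)) \<subseteq> insert \<infinity> (enat ` {1..n}) \<and>
        (\<forall>j1\<in>{1..n}. \<forall>j2\<in>{1..n}.
           Out (i1, i2) ! (j1 - 1) = enat j2 \<longleftrightarrow> ((i1, j1), (i2, j2)) \<in> E))"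

text \<open>``Highest'' means smallest position. \<open>Inf {}\<close> is \<open>\<infinity>\<close> on \<^typ>\<open>enat\<close>, so
  \<open>\<infinity>\<close> stands for the absence of a successor and \<open>None\<close> for the absence of a
  predecessor. Reachability is reflexive.\<close>

definition highest_successor :: "node rel \<Rightarrow> node \<Rightarrow> nat \<Rightarrow> enat" where
  "highest_successor E u i = Inf (enat ` {j. reaches E u (i, j)})"

definition lowest_predecessor :: "node rel \<Rightarrow> node \<Rightarrow> nat \<Rightarrow> nat option" where
  "lowest_predecessor E u i =
     (if \<exists>j. reaches E (i, j) u then Some (Max {j. reaches E (i, j) u}) else None)"

definition suffix_min :: "enat list \<Rightarrow> nat \<Rightarrow> enat" where
  "suffix_min A i = (MIN j\<in>{i..length A}. A ! (j - 1))"

text \<open>The invariant of the data structure, as a property of the underlying arrays. Required of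
  the arrays \<open>Out\<close>, it says that the initial trees, which contain exactly these arrays, satisfy
  the invariant; this holds in particular if there are no cross-chain edges yet, and whenever
  there are at most two chains. It does not follow from \<^const>\<open>chain_representation\<close>: if the
  only cross-chain edges are \<open>((1, 1), (2, 1))\<close> and \<open>((2, 1), (3, 1))\<close>, then
  \<open>Out (1, 3)\<close> contains only \<open>\<infinity>\<close>, although \<open>(1, 1)\<close> reaches \<open>(3, 1)\<close>.\<close>

definition reachability_invariant ::
  "nat \<Rightarrow> node set \<Rightarrow> node rel \<Rightarrow> (nat \<times> nat \<Rightarrow> enat list) \<Rightarrow> bool" where
  "reachability_invariant k V E A \<longleftrightarrow>
     (\<forall>i1\<in>{1..k}. \<forall>i2\<in>{1..k}. i1 \<noteq> i2 \<longrightarrow>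
        (\<forall>j1. (i1, j1) \<in> V \<longrightarrow>
           suffix_min (A (i1, i2)) j1 = highest_successor E (i1, j1) i2))"


section \<open>Incremental reachability\<close>

datatype operation =
    Insert node node
  | Query node node
  | Successor node nat
  | Predecessor node nat

datatype answer =
    Inserted
  | Reachable bool
  | Succ_Pos enat
  | Pred_Pos "nat option"

fun edges_after :: "node rel \<Rightarrow> operation \<Rightarrow> node rel" where
  "edges_after E (Insert u v) = insert (u, v) E"
| "edges_after E _ = E"

fun legal :: "nat \<Rightarrow> node set \<Rightarrow> node rel \<Rightarrow> operation \<Rightarrow> bool" where
  "legal k V E (Insert u v) \<longleftrightarrow> u \<in> V \<and> v \<in> V \<and> \<not> reaches E v u"
| "legal k V E (Query u v) \<longleftrightarrow> u \<in> V \<and> v \<in> V"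
| "legal k V E (Successor u i) \<longleftrightarrow> u \<in> V \<and> i \<in> {1..k}"
| "legal k V E (Predecessor u i) \<longleftrightarrow> u \<in> V \<and> i \<in> {1..k}"

fun correct_answer :: "node rel \<Rightarrow> operation \<Rightarrow> answer" where
  "correct_answer E (Insert u v) = Inserted"
| "correct_answer E (Query u v) = Reachable (reaches E u v)"
| "correct_answer E (Successor u i) = Succ_Pos (highest_successor E u i)"
| "correct_answer E (Predecessor u i) = Pred_Pos (lowest_predecessor E u i)"

fun legal_sequence :: "nat \<Rightarrow> node set \<Rightarrow> node rel \<Rightarrow> operation list \<Rightarrow> bool" where
  "legal_sequence k V E [] \<longleftrightarrow> True"
| "legal_sequence k V E (x # xs) \<longleftrightarrow>
     legal k V E x \<and> legal_sequence k V (edges_after E x) xs"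

fun correct_answers :: "node rel \<Rightarrow> operation list \<Rightarrow> answer list" where
  "correct_answers E [] = []"
| "correct_answers E (x # xs) = correct_answer E x # correct_answers (edges_after E x) xs"


section \<open>Timed computations and Fenwick trees\<close>

text \<open>A timed computation is a result together with the number of steps spent on it.\<close>

type_synonym 'a timed = "'a \<times> nat"

definition bind_timed :: "'a timed \<Rightarrow> ('a \<Rightarrow> 'b timed) \<Rightarrow> 'b timed" where
  "bind_timed m f = (let (x, c) = m; (y, d) = f x in (y, c + d))"

adhoc_overloading Monad_Syntax.bind \<rightleftharpoons> bind_timed

definition finish :: "'a \<Rightarrow> 'a timed" where
  "finish x = (x, 1)"

text \<open>The interface of Fenwick trees; \<open>'f\<close> is the type of the tree states.\<close>

record 'f fenwick =
  ft_init :: "enat list \<Rightarrow> 'f timed"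
  ft_update :: "'f \<Rightarrow> nat \<Rightarrow> enat \<Rightarrow> 'f timed"
  ft_min :: "'f \<Rightarrow> nat \<Rightarrow> enat timed"
  ft_argleq :: "'f \<Rightarrow> nat \<Rightarrow> nat option timed"

text \<open>\<open>stores F A\<close> means that the state \<open>F\<close> is a Fenwick tree for the array \<open>A\<close>.\<close>

definition fenwick_correct :: "'f fenwick \<Rightarrow> ('f \<Rightarrow> enat list \<Rightarrow> bool) \<Rightarrow> bool" where
  "fenwick_correct FT stores \<longleftrightarrow>
     (\<forall>A. stores (fst (ft_init FT A)) A) \<and>
     (\<forall>F A. stores F A \<longrightarrow>
        (\<forall>i\<in>{1..length A}. \<forall>x. stores (fst (ft_update FT F i x)) (A[i - 1 := x])) \<and>
        (\<forall>i\<in>{1..length A}. fst (ft_min FT F i) = suffix_min A i) \<and>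
        (\<forall>i. fst (ft_argleq FT F i) =
           (let J = {j \<in> {1..length A}. A ! (j - 1) \<le> enat i}
            in if J = {} then None else Some (Max J))))"

definition fenwick_fast :: "'f fenwick \<Rightarrow> ('f \<Rightarrow> enat list \<Rightarrow> bool) \<Rightarrow> bool" where
  "fenwick_fast FT stores \<longleftrightarrow>
     (\<exists>p q :: nat \<Rightarrow> real. p \<in> O(\<lambda>n. real n) \<and> q \<in> O(\<lambda>n. ln (real n)) \<and>
        (\<forall>A. real (snd (ft_init FT A)) \<le> p (length A)) \<and>
        (\<forall>F A. stores F A \<longrightarrow>
           (\<forall>i\<in>{1..length A}. \<forall>x. real (snd (ft_update FT F i x)) \<le> q (length A)) \<and>
           (\<forall>i\<in>{1..length A}. real (snd (ft_min FT F i)) \<le> q (length A)) \<and>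
           (\<forall>i. real (snd (ft_argleq FT F i)) \<le> q (length A))))"

definition fenwick_tree :: "'f fenwick \<Rightarrow> bool" where
  "fenwick_tree FT \<longleftrightarrow> (\<exists>stores. fenwick_correct FT stores \<and> fenwick_fast FT stores)"


section \<open>The data structure\<close>

text \<open>A state maps \<open>(i1, i2)\<close> to the tree for chains \<open>i1 \<noteq> i2\<close>. Apart from the calls of
  Fenwick tree operations, every loop iteration and every operation performs a constant number
  of elementary steps; each such block of steps is charged by a \<^const>\<open>finish\<close>.\<close>

type_synonym 'f ds = "nat \<times> nat \<Rightarrow> 'f"

definition chain_pairs :: "nat \<Rightarrow> (nat \<times> nat) list" where
  "chain_pairs k = List.product [1..<Suc k] [1..<Suc k]"

fun init_loop :: "'f fenwick \<Rightarrow> (nat \<times> nat \<Rightarrow> enat list) \<Rightarrow> (nat \<times> nat) list \<Rightarrow> 'f ds \<Rightarrow>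
    'f ds timed" where
  "init_loop FT Out [] D = finish D"
| "init_loop FT Out ((i1, i2) # ps) D =
     (if i1 = i2 then do { D' \<leftarrow> finish D; init_loop FT Out ps D' }
      else do {
        F \<leftarrow> ft_init FT (Out (i1, i2));
        D' \<leftarrow> finish (D((i1, i2) := F));
        init_loop FT Out ps D'
      })"

definition ds_init :: "'f fenwick \<Rightarrow> nat \<Rightarrow> (nat \<times> nat \<Rightarrow> enat list) \<Rightarrow> 'f ds timed" where
  "ds_init FT k Out = init_loop FT Out (chain_pairs k) (\<lambda>_. undefined)"

fun ds_successor :: "'f fenwick \<Rightarrow> 'f ds \<Rightarrow> node \<Rightarrow> nat \<Rightarrow> enat timed" where
  "ds_successor FT D (i1, j1) i =
     (if i = i1 then finish (enat j1)
      else do { j \<leftarrow> ft_min FT (D (i1, i)) j1; finish j })"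

fun ds_predecessor :: "'f fenwick \<Rightarrow> 'f ds \<Rightarrow> node \<Rightarrow> nat \<Rightarrow> nat option timed" where
  "ds_predecessor FT D (i1, j1) i =
     (if i = i1 then finish (Some j1)
      else do { j \<leftarrow> ft_argleq FT (D (i, i1)) j1; finish j })"

text \<open>The tree is only updated if this improves on the successor it already knows.
  An unconditional update is incorrect, since \<^const>\<open>ft_update\<close> overwrites the old
  entry: inserting \<open>((1, 1), (3, 1))\<close>, \<open>((2, 1), (3, 5))\<close> and \<open>((1, 1), (2, 1))\<close>
  would replace the entry \<open>1\<close> of the tree \<open>(1, 3)\<close> at position \<open>1\<close> by \<open>5\<close>.\<close>

definition improve :: "'f fenwick \<Rightarrow> 'f ds \<Rightarrow> nat \<times> nat \<Rightarrow> nat \<Rightarrow> enat \<Rightarrow> 'f ds timed" where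
  "improve FT D p j1 j2 = do {
     m \<leftarrow> ft_min FT (D p) j1;
     if j2 < m then do { F \<leftarrow> ft_update FT (D p) j1 j2; finish (D(p := F)) }
     else finish D
   }"

fun insert_loop :: "'f fenwick \<Rightarrow> node \<Rightarrow> node \<Rightarrow> (nat \<times> nat) list \<Rightarrow> 'f ds \<Rightarrow> 'f ds timed" where
  "insert_loop FT u v [] D = finish D"
| "insert_loop FT u v ((i1', i2') # ps) D = do {
     p1 \<leftarrow> ds_predecessor FT D u i1';
     j2' \<leftarrow> ds_successor FT D v i2';
     D' \<leftarrow> (case p1 of
              None \<Rightarrow> finish D
            | Some j1' \<Rightarrow>
                if i1' = i2' \<or> j2' = \<infinity> then finish D
                else improve FT D (i1', i2') j1' j2');
     insert_loop FT u v ps D'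
   }"

definition ds_insert :: "'f fenwick \<Rightarrow> nat \<Rightarrow> 'f ds \<Rightarrow> node \<Rightarrow> node \<Rightarrow> 'f ds timed" where
  "ds_insert FT k D u v = insert_loop FT u v (chain_pairs k) D"

definition ds_query :: "'f fenwick \<Rightarrow> 'f ds \<Rightarrow> node \<Rightarrow> node \<Rightarrow> bool timed" where
  "ds_query FT D u v = do {
     j2' \<leftarrow> ds_successor FT D u (fst v);
     finish (j2' \<le> enat (snd v))
   }"

fun ds_step :: "'f fenwick \<Rightarrow> nat \<Rightarrow> 'f ds \<Rightarrow> operation \<Rightarrow> ('f ds \<times> answer) timed" where
  "ds_step FT k D (Insert u v) = do { D' \<leftarrow> ds_insert FT k D u v; finish (D', Inserted) }"
| "ds_step FT k D (Query u v) = do { b \<leftarrow> ds_query FT D u v; finish (D, Reachable b) }"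
| "ds_step FT k D (Successor u i) = do { j \<leftarrow> ds_successor FT D u i; finish (D, Succ_Pos j) }"
| "ds_step FT k D (Predecessor u i) =
     do { j \<leftarrow> ds_predecessor FT D u i; finish (D, Pred_Pos j) }"

text \<open>The answers to the operations of a sequence, each with the time spent on that operation.\<close>

fun ds_run :: "'f fenwick \<Rightarrow> nat \<Rightarrow> 'f ds \<Rightarrow> operation list \<Rightarrow> answer timed list" where
  "ds_run FT k D [] = []"
| "ds_run FT k D (x # xs) =
     (let ((D', a), c) = ds_step FT k D x in (a, c) # ds_run FT k D' xs)"

end

theory Submission
  imports Defs
begin

text \<open>Inserting \<open>(u, v)\<close> adds exactly the paths \<open>w \<leadsto> u \<rightarrow> v \<leadsto> x\<close>. Hence the highest successor of
  \<open>w\<close> in chain \<open>i\<close> is lowered to that of \<open>v\<close> iff \<open>w\<close> reaches \<open>u\<close>, that is, iff \<open>w\<close> is not below the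
  lowest predecessor of \<open>u\<close> in its chain, and this is the effect of one point update on the suffix
  minima. The insertion loop reads trees it has already changed; this is harmless because, \<open>v\<close> not
  reaching \<open>u\<close>, neither the successors of \<open>v\<close> nor the predecessors of \<open>u\<close> are affected.\<close>

section \<open>Suffix minima\<close>

text \<open>Finite upper bounds determine an extended natural number, \<open>\<infinity>\<close>
  being the one without any. This turns equations between minima and infima into existence
  statements.\<close>

lemma enat_eqI:
  fixes a b :: enat
  assumes "\<And>x. a \<le> enat x \<longleftrightarrow> b \<le> enat x"
  shows "a = b"
proof (rule order_antisym)
  show "a \<le> b" using assms by (cases b) auto
  show "b \<le> a" using assms by (cases a) auto
qed

lemma suffix_min_le_iff:
  assumes "i \<le> length A"
  shows "suffix_min A i \<le> x \<longleftrightarrow> (\<exists>j\<in>{i..length A}. A ! (j - 1) \<le> x)"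
  using assms unfolding suffix_min_def by (subst Min_le_iff) auto

lemma suffix_min_antimono:
  assumes "i \<le> j" "j \<le> length A"
  shows "suffix_min A i \<le> suffix_min A j"
  using assms unfolding suffix_min_def by (intro Min_antimono image_mono) auto

text \<open>The overwritten entry is at least \<open>suffix_min A i\<close> and so exceeds
  \<open>x\<close>. Losing it raises no suffix minimum, and the update acts as if \<open>x\<close>
  were added beside the old entry.\<close>

lemma suffix_min_list_update:
  assumes i: "i \<in> {1..length A}" and j: "j \<in> {1..length A}" and x: "x < suffix_min A i"
  shows "suffix_min (A[i - 1 := x]) j =
    (if j \<le> i then min (suffix_min A j) x else suffix_min A j)"
proof -
  have nth: "A[i - 1 := x] ! (l - 1) = (if l = i then x else A ! (l - 1))"
    if "l \<in> {j..length A}" for l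
    using that i j by (auto simp: nth_list_update)
  have Ai: "x < A ! (i - 1)"
    using x i suffix_min_le_iff[of i A "A ! (i - 1)"] by fastforce
  have "suffix_min (A[i - 1 := x]) j \<le> y \<longleftrightarrow>
      (if j \<le> i then min (suffix_min A j) x else suffix_min A j) \<le> y" for y
  proof -
    have "suffix_min (A[i - 1 := x]) j \<le> y \<longleftrightarrow>
        (\<exists>l\<in>{j..length A}. (if l = i then x else A ! (l - 1)) \<le> y)"
      using j nth by (auto simp: suffix_min_le_iff)
    also have "\<dots> \<longleftrightarrow> (\<exists>l\<in>{j..length A}. A ! (l - 1) \<le> y) \<or> j \<le> i \<and> x \<le> y"
      using i Ai by (auto split: if_splits) (metis atLeastAtMost_iff order.strict_implies_order order_trans)+
    also have "\<dots> \<longleftrightarrow> (if j \<le> i then min (suffix_min A j) x else suffix_min A j) \<le> y"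
      using j by (auto simp: suffix_min_le_iff min_le_iff_disj)
    finally show ?thesis .
  qed
  then show ?thesis by (rule enat_eqI)
qed


section \<open>Successors and predecessors\<close>

text \<open>The infimum of a non-empty set of naturals is attained, and that of the empty set is
  \<open>\<infinity>\<close>, which is below no \<open>enat x\<close>.\<close>

lemma highest_successor_le_iff:
  "highest_successor E u i \<le> enat x \<longleftrightarrow> (\<exists>j\<le>x. reaches E u (i, j))"
proof
  assume le: "highest_successor E u i \<le> enat x"
  let ?S = "enat ` {j. reaches E u (i, j)}"
  have "?S \<noteq> {}"
  proof
    assume "?S = {}"
    with le show False by (simp add: highest_successor_def Inf_enat_def)
  qed
  then have "Inf ?S \<in> ?S"
    unfolding Inf_enat_def by (auto intro: LeastI)
  with le show "\<exists>j\<le>x. reaches E u (i, j)"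
    by (auto simp: highest_successor_def)
next
  assume "\<exists>j\<le>x. reaches E u (i, j)"
  then show "highest_successor E u i \<le> enat x"
    unfolding highest_successor_def
    by (metis (mono_tags, lifting) Inf_lower enat_ord_simps(1) imageI mem_Collect_eq order_trans)
qed

lemma reaches_insert_iff:
  "reaches (insert (u, v) E) w x \<longleftrightarrow> reaches E w x \<or> reaches E w u \<and> reaches E v x"
  by (auto simp: rtrancl_insert)

lemma highest_successor_insert:
  "highest_successor (insert (u, v) E) w i =
    (if reaches E w u then min (highest_successor E w i) (highest_successor E v i)
     else highest_successor E w i)"
  by (rule enat_eqI)
    (auto simp: highest_successor_le_iff reaches_insert_iff min_le_iff_disj)

text \<open>A new path from \<open>v\<close> through the inserted edge would first have to reach
  \<open>u\<close>. With its dual \<open>lowest_predecessor_insert_source\<close>, this lets the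
  insertion loop read old and new trees alike.\<close>

lemma highest_successor_insert_target:
  assumes "\<not> reaches E v u"
  shows "highest_successor (insert (u, v) E) v i = highest_successor E v i"
  using assms by (simp add: highest_successor_insert)

lemma lowest_predecessor_insert_source:
  assumes "\<not> reaches E v u"
  shows "lowest_predecessor (insert (u, v) E) u i = lowest_predecessor E u i"
  using assms by (simp add: lowest_predecessor_def reaches_insert_iff)


section \<open>Chains\<close>

text \<open>Only the node set is fixed here: insertions change the edges, which are therefore a
  parameter of \<open>chain_dag\<close>.\<close>

locale chains =
  fixes k n :: nat and V :: "node set"
  assumes V_subset: "V \<subseteq> {1..k} \<times> {1..n}"
    and V_downward: "(i, j) \<in> V \<Longrightarrow> 1 \<le> j' \<Longrightarrow> j' \<le> j \<Longrightarrow> (i, j') \<in> V"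
begin

lemma V_bounds:
  assumes "(i, j) \<in> V"
  shows "i \<in> {1..k}" "j \<in> {1..n}"
  using assms V_subset by auto

text \<open>This collects what legal insertions preserve; the arrays \<open>Out\<close> describe the
  initial edges only.\<close>

definition chain_dag :: "node rel \<Rightarrow> bool" where
  "chain_dag E \<longleftrightarrow> acyclic E \<and> E \<subseteq> V \<times> V \<and>
     (\<forall>i j. (i, j) \<in> V \<and> (i, Suc j) \<in> V \<longrightarrow> ((i, j), (i, Suc j)) \<in> E)"

lemma chain_dag_insert:
  assumes "chain_dag E" "u \<in> V" "v \<in> V" "\<not> reaches E v u"
  shows "chain_dag (insert (u, v) E)"
  using assms by (auto simp: chain_dag_def)

text \<open>An equivalence rather than membership, since the reflexive closure also relates pairs
  outside \<open>V\<close> to themselves.\<close>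

lemma reaches_in_V:
  assumes "chain_dag E" "reaches E u v"
  shows "u \<in> V \<longleftrightarrow> v \<in> V"
proof -
  have "E \<subseteq> V \<times> V" using assms(1) by (simp add: chain_dag_def)
  with assms(2) show ?thesis by (induction rule: rtrancl_induct) auto
qed

lemma reaches_chain:
  assumes E: "chain_dag E" and "(i, j') \<in> V" "1 \<le> j" "j \<le> j'"
  shows "reaches E (i, j) (i, j')"
  using assms(4,2)
proof (induction j' rule: dec_induct)
  case (step m)
  have "(i, m) \<in> V" using V_downward[of i "Suc m" m] step assms(3) by auto
  with step E show ?case by (auto simp: chain_dag_def intro: rtrancl_into_rtrancl)
qed auto

text \<open>Chain edges lead downwards, and acyclicity excludes any path back up.\<close>

lemma reaches_same_chain_iff:
  assumes E: "chain_dag E" and V: "(i, j) \<in> V" "(i, j') \<in> V"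
  shows "reaches E (i, j) (i, j') \<longleftrightarrow> j \<le> j'"
proof
  assume r: "reaches E (i, j) (i, j')"
  show "j \<le> j'"
  proof (rule ccontr)
    assume "\<not> j \<le> j'"
    then have "reaches E (i, j') (i, j)" "j \<noteq> j'"
      using reaches_chain[OF E V(1), of j'] V_bounds[OF V(2)] by auto
    moreover have "antisym (E\<^sup>*)"
      using E by (simp add: chain_dag_def acyclic_impl_antisym_rtrancl)
    ultimately show False using r by (auto dest: antisymD)
  qed
qed (use reaches_chain[OF E V(2)] V_bounds[OF V(1)] in auto)

text \<open>The nodes of a chain reachable from \<open>u\<close> are closed under going down the
  chain, so comparing positions decides reachability. This is the test made by a query.\<close>

lemma highest_successor_le_node_iff:
  assumes E: "chain_dag E" and u: "u \<in> V" and V: "(i, j) \<in> V"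
  shows "highest_successor E u i \<le> enat j \<longleftrightarrow> reaches E u (i, j)"
proof -
  have "reaches E u (i, j)" if r: "reaches E u (i, j')" "j' \<le> j" for j'
  proof -
    have "(i, j') \<in> V" using reaches_in_V[OF E r(1)] u by simp
    then have "reaches E (i, j') (i, j)"
      using reaches_same_chain_iff[OF E _ V] r(2) by simp
    with r(1) show ?thesis by (rule rtrancl_trans)
  qed
  then show ?thesis by (auto simp: highest_successor_le_iff)
qed

text \<open>No tree belongs to a single chain; this and \<open>lowest_predecessor_same_chain\<close>
  justify the direct answers of \<open>ds_successor\<close> and \<open>ds_predecessor\<close> for
  the node's own chain.\<close>

lemma highest_successor_same_chain:
  assumes E: "chain_dag E" and V: "(i, j) \<in> V"
  shows "highest_successor E (i, j) i = enat j"
proof (rule enat_eqI)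
  fix x
  have "j \<le> j'" if "reaches E (i, j) (i, j')" for j'
    using reaches_in_V[OF E that] reaches_same_chain_iff[OF E V, of j'] that V by simp
  then show "highest_successor E (i, j) i \<le> enat x \<longleftrightarrow> enat j \<le> enat x"
    by (force simp: highest_successor_le_iff)
qed

lemma finite_predecessors:
  assumes E: "chain_dag E" and u: "u \<in> V"
  shows "finite {j. reaches E (i, j) u}"
proof (rule finite_subset)
  show "{j. reaches E (i, j) u} \<subseteq> {1..n}"
    using reaches_in_V[OF E] u V_bounds(2) by blast
qed simp

lemma lowest_predecessor_same_chain:
  assumes E: "chain_dag E" and V: "(i, j) \<in> V"
  shows "lowest_predecessor E (i, j) i = Some j"
proof -
  have "j' \<le> j" if "reaches E (i, j') (i, j)" for j'
    using reaches_in_V[OF E that] reaches_same_chain_iff[OF E _ V, of j'] that V by simp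
  then have "Max {j'. reaches E (i, j') (i, j)} = j"
    using finite_predecessors[OF E V] by (intro Max_eqI) auto
  then show ?thesis by (auto simp: lowest_predecessor_def)
qed

text \<open>The predecessors of \<open>u\<close> in chain \<open>i\<close> form an initial segment
  of the chain, whose last position is the maximum.\<close>

lemma lowest_predecessor_SomeD:
  assumes E: "chain_dag E" and u: "u \<in> V" and Some: "lowest_predecessor E u i = Some j"
  shows "(i, j) \<in> V" "(i, j') \<in> V \<Longrightarrow> reaches E (i, j') u \<longleftrightarrow> j' \<le> j"
proof -
  note fin = finite_predecessors[OF E u, of i]
  have ne: "{j. reaches E (i, j) u} \<noteq> {}" and j: "j = Max {j. reaches E (i, j) u}"
    using Some by (auto simp: lowest_predecessor_def split: if_splits)
  then have r: "reaches E (i, j) u"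
    using Max_in[OF fin ne] by simp
  then show V: "(i, j) \<in> V"
    using reaches_in_V[OF E] u by blast
  show "reaches E (i, j') u \<longleftrightarrow> j' \<le> j" if V': "(i, j') \<in> V"
  proof
    assume "reaches E (i, j') u"
    then show "j' \<le> j" unfolding j using fin by simp
  next
    assume "j' \<le> j"
    then have "reaches E (i, j') (i, j)"
      using reaches_same_chain_iff[OF E V' V] by simp
    then show "reaches E (i, j') u" using r by (rule rtrancl_trans)
  qed
qed

end


section \<open>Operations of the data structure\<close>

lemma fst_bind_timed [simp]: "fst (bind_timed m f) = fst (f (fst m))"
  and snd_bind_timed [simp]: "snd (bind_timed m f) = snd m + snd (f (fst m))"
  by (simp_all add: bind_timed_def split: prod.splits)

lemma fst_finish [simp]: "fst (finish x) = x"
  and snd_finish [simp]: "snd (finish x) = 1"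
  by (simp_all add: finish_def)

lemma set_chain_pairs: "set (chain_pairs k) = {1..k} \<times> {1..k}"
  by (auto simp: chain_pairs_def)

lemma length_chain_pairs: "length (chain_pairs k) = k\<^sup>2"
  by (simp add: chain_pairs_def power2_eq_square)

section \<open>Initialization of the trees\<close>

lemma init_loop_correct:
  assumes "(i1, i2) \<in> set ps" "i1 \<noteq> i2"
  shows "fst (init_loop FT Out ps D) (i1, i2) = fst (ft_init FT (Out (i1, i2)))"
proof -
  \<comment> \<open>The induction also needs the value at pairs outside the list, because a tree
    already built must survive the remaining iterations.\<close>
  have "fst (init_loop FT Out ps D) (i1, i2) =
      (if (i1, i2) \<in> set ps then fst (ft_init FT (Out (i1, i2))) else D (i1, i2))"
    using assms(2) by (induction FT Out ps D rule: init_loop.induct) auto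
  with assms(1) show ?thesis by simp
qed

text \<open>Each iteration is charged \<open>P + 1\<close>, which covers a diagonal pair because
  \<open>0 \<le> P\<close>; the last \<open>1\<close> pays for the empty list.\<close>

lemma init_loop_time:
  assumes "\<And>i1 i2. (i1, i2) \<in> set ps \<Longrightarrow> i1 \<noteq> i2 \<Longrightarrow> real (snd (ft_init FT (Out (i1, i2)))) \<le> P"
    and "0 \<le> P"
  shows "real (snd (init_loop FT Out ps D)) \<le> real (length ps) * (P + 1) + 1"
  using assms(1)
proof (induction ps arbitrary: D)
  case (Cons p ps)
  obtain i1 i2 where p: "p = (i1, i2)" by (cases p)
  show ?case
  proof (cases "i1 = i2")
    case True
    then show ?thesis
      using Cons.IH[of D] Cons.prems assms(2) by (auto simp: p algebra_simps)
  next
    case False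
    have "real (snd (init_loop FT Out ps (D((i1, i2) := fst (ft_init FT (Out (i1, i2))))))) \<le>
        real (length ps) * (P + 1) + 1"
      using Cons.prems by (intro Cons.IH) auto
    moreover have "real (snd (ft_init FT (Out (i1, i2)))) \<le> P"
      using Cons.prems False by (simp add: p)
    ultimately show ?thesis using False by (simp add: p algebra_simps)
  qed
qed simp

section \<open>Reading successors and predecessors off the trees\<close>

text \<open>All trees have length \<open>n\<close>, so one number \<open>T\<close> bounds every
  update and every reading of a tree; growth in \<open>n\<close> is considered only in the final
  theorem.\<close>

locale ds_chains = chains k n V
  for k n :: nat and V :: "node set" +
  fixes FT :: "'f fenwick" and stores :: "'f \<Rightarrow> enat list \<Rightarrow> bool" and T :: real
  assumes correct: "fenwick_correct FT stores"
    and update_time: "stores F A \<Longrightarrow> length A = n \<Longrightarrow> i \<in> {1..n} \<Longrightarrow>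
      real (snd (ft_update FT F i x)) \<le> T"
    and min_time: "stores F A \<Longrightarrow> length A = n \<Longrightarrow> i \<in> {1..n} \<Longrightarrow> real (snd (ft_min FT F i)) \<le> T"
    and argleq_time: "stores F A \<Longrightarrow> length A = n \<Longrightarrow> real (snd (ft_argleq FT F m)) \<le> T"
    and T_nonneg: "0 \<le> T"
begin

text \<open>Positions beyond the end of chain \<open>i1\<close> have to hold \<open>\<infinity>\<close>, since \<^const>\<open>ft_argleq\<close>
  searches the whole array.\<close>

definition tree_ok :: "node rel \<Rightarrow> nat \<Rightarrow> nat \<Rightarrow> 'f \<Rightarrow> bool" where
  "tree_ok E i1 i2 F \<longleftrightarrow> (\<exists>A. stores F A \<and> length A = n \<and>
     (\<forall>j\<in>{1..n}. (i1, j) \<notin> V \<longrightarrow> A ! (j - 1) = \<infinity>) \<and>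
     (\<forall>j. (i1, j) \<in> V \<longrightarrow> suffix_min A j = highest_successor E (i1, j) i2))"

definition trees_ok :: "node rel \<Rightarrow> 'f ds \<Rightarrow> bool" where
  "trees_ok E D \<longleftrightarrow> (\<forall>i1\<in>{1..k}. \<forall>i2\<in>{1..k}. i1 \<noteq> i2 \<longrightarrow> tree_ok E i1 i2 (D (i1, i2)))"

lemma ft_min_tree_ok:
  assumes "tree_ok E i1 i2 F" "(i1, j) \<in> V"
  shows "fst (ft_min FT F j) = highest_successor E (i1, j) i2" "real (snd (ft_min FT F j)) \<le> T"
  using assms V_bounds[OF assms(2)] correct min_time
  by (auto simp: tree_ok_def fenwick_correct_def)

text \<open>A node of chain \<open>i1\<close> reaches \<open>(i2, m)\<close> iff its suffix minimum
  is at most \<open>m\<close>, that is, iff an entry at most \<open>m\<close> occurs at or after its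
  position. Hence the predecessors \<open>P\<close> are the positions up to some element of
  \<open>J\<close>, and the two maxima agree.\<close>

lemma ft_argleq_tree_ok:
  assumes E: "chain_dag E" and F: "tree_ok E i1 i2 F" and V: "(i2, m) \<in> V"
  shows "fst (ft_argleq FT F m) = lowest_predecessor E (i2, m) i1"
    "real (snd (ft_argleq FT F m)) \<le> T"
proof -
  obtain A where A: "stores F A" "length A = n"
    and out: "\<And>j. j \<in> {1..n} \<Longrightarrow> (i1, j) \<notin> V \<Longrightarrow> A ! (j - 1) = \<infinity>"
    and sm: "\<And>j. (i1, j) \<in> V \<Longrightarrow> suffix_min A j = highest_successor E (i1, j) i2"
    using F by (auto simp: tree_ok_def)
  show "real (snd (ft_argleq FT F m)) \<le> T" using A by (rule argleq_time)
  define J where "J = {j \<in> {1..n}. A ! (j - 1) \<le> enat m}"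
  define P where "P = {j. reaches E (i1, j) (i2, m)}"
  have fin: "finite P" unfolding P_def by (rule finite_predecessors[OF E V])
  have reach: "j \<in> P \<longleftrightarrow> (\<exists>j'\<in>J. j \<le> j')" if "(i1, j) \<in> V" for j
    using highest_successor_le_node_iff[OF E that V] sm[OF that] V_bounds[OF that] A(2)
      suffix_min_le_iff[of j A "enat m"]
    by (fastforce simp: J_def P_def)
  have JP: "J \<subseteq> P"
  proof
    fix j assume j: "j \<in> J"
    \<comment> \<open>Entries beyond the end of the chain are \<open>\<infinity>\<close>, so the
      search cannot stop there.\<close>
    have "(i1, j) \<in> V"
    proof (rule ccontr)
      assume "(i1, j) \<notin> V"
      with out[of j] j show False by (simp add: J_def)
    qed
    then show "j \<in> P" using reach j by blast
  qed
  have PJ: "\<exists>j'\<in>J. j \<le> j'" if "j \<in> P" for j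
    using that reach reaches_in_V[OF E, of "(i1, j)"] V by (auto simp: P_def)
  have finJ: "finite J" by (simp add: J_def)
  have "Max J = Max P" if "J \<noteq> {}"
  proof (rule order_antisym)
    show "Max J \<le> Max P" using JP that fin by (rule Max_mono)
    show "Max P \<le> Max J"
      using JP that finJ PJ[OF Max_in[OF fin]] by (auto simp: Max_ge_iff)
  qed
  moreover have "J = {} \<longleftrightarrow> P = {}" using JP PJ by blast
  moreover have "fst (ft_argleq FT F m) = (if J = {} then None else Some (Max J))"
    using correct A unfolding fenwick_correct_def J_def by (simp add: Let_def)
  ultimately show "fst (ft_argleq FT F m) = lowest_predecessor E (i2, m) i1"
    by (auto simp: lowest_predecessor_def P_def)
qed

text \<open>Only the tree actually read is assumed correct, and not all of \<open>trees_ok\<close>,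
  since during an insertion different trees may fit different edge relations.\<close>

lemma ds_successor_correct:
  assumes E: "chain_dag E" and u: "u \<in> V" and ok: "fst u \<noteq> i \<Longrightarrow> tree_ok E (fst u) i (D (fst u, i))"
  shows "fst (ds_successor FT D u i) = highest_successor E u i"
    "real (snd (ds_successor FT D u i)) \<le> T + 1"
  using assms ft_min_tree_ok[of E "fst u" i _ "snd u"] T_nonneg
  by (cases u; auto simp: highest_successor_same_chain)+

lemma ds_predecessor_correct:
  assumes E: "chain_dag E" and u: "u \<in> V" and ok: "fst u \<noteq> i \<Longrightarrow> tree_ok E i (fst u) (D (i, fst u))"
  shows "fst (ds_predecessor FT D u i) = lowest_predecessor E u i"
    "real (snd (ds_predecessor FT D u i)) \<le> T + 1"
  using assms ft_argleq_tree_ok[of E i "fst u" _ "snd u"] T_nonneg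
  by (cases u; auto simp: lowest_predecessor_same_chain)+

section \<open>Insertion\<close>

text \<open>\<open>G\<close> is the edge relation that the tree fits beforehand and \<open>H\<close>
  the one it has to fit afterwards. The cost consists of one minimum, at most one update and one
  \<open>finish\<close>.\<close>

lemma improve_correct:
  assumes F: "tree_ok G i1 i2 (D (i1, i2))" and V: "(i1, j1) \<in> V"
    and H: "\<And>j. (i1, j) \<in> V \<Longrightarrow> highest_successor H (i1, j) i2 =
      (if j \<le> j1 then min (highest_successor G (i1, j) i2) j2 else highest_successor G (i1, j) i2)"
  shows "\<exists>F'. fst (improve FT D (i1, i2) j1 j2) = D((i1, i2) := F') \<and> tree_ok H i1 i2 F'"
    "real (snd (improve FT D (i1, i2) j1 j2)) \<le> 2 * T + 1"
proof -
  obtain A where A: "stores (D (i1, i2)) A" "length A = n"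
    and out: "\<And>j. j \<in> {1..n} \<Longrightarrow> (i1, j) \<notin> V \<Longrightarrow> A ! (j - 1) = \<infinity>"
    and sm: "\<And>j. (i1, j) \<in> V \<Longrightarrow> suffix_min A j = highest_successor G (i1, j) i2"
    using F by (auto simp: tree_ok_def)
  note j1 = V_bounds(2)[OF V]
  have m: "fst (ft_min FT (D (i1, i2)) j1) = suffix_min A j1"
    using ft_min_tree_ok[OF F V] sm[OF V] by simp
  show "real (snd (improve FT D (i1, i2) j1 j2)) \<le> 2 * T + 1"
    using ft_min_tree_ok(2)[OF F V] update_time[OF A j1, of j2] T_nonneg
    by (auto simp: improve_def)
  show "\<exists>F'. fst (improve FT D (i1, i2) j1 j2) = D((i1, i2) := F') \<and> tree_ok H i1 i2 F'"
  proof (cases "j2 < suffix_min A j1")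
    case True
    let ?F = "fst (ft_update FT (D (i1, i2)) j1 j2)" and ?A = "A[j1 - 1 := j2]"
    have "stores ?F ?A" using correct A j1 by (simp add: fenwick_correct_def)
    moreover have "?A ! (j - 1) = \<infinity>" if "j \<in> {1..n}" "(i1, j) \<notin> V" for j
    proof -
      have "j - 1 \<noteq> j1 - 1" using that V j1 by (metis atLeastAtMost_iff le_add_diff_inverse)
      then show ?thesis using out[OF that] by simp
    qed
    moreover have "suffix_min ?A j = highest_successor H (i1, j) i2" if "(i1, j) \<in> V" for j
      using suffix_min_list_update[of j1 A j j2] True j1 V_bounds(2)[OF that] A(2) sm[OF that]
        H[OF that] by simp
    ultimately have "tree_ok H i1 i2 ?F"
      using A(2) unfolding tree_ok_def by (intro exI[of _ ?A]) auto
    then show ?thesis using True by (auto simp: improve_def m)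
  next
    case False
    \<comment> \<open>For \<open>j \<le> j1\<close> the suffix minimum is at most the one at
      \<open>j1\<close>, hence at most \<open>j2\<close>, and taking the minimum with
      \<open>j2\<close> changes nothing.\<close>
    have "suffix_min A j = highest_successor H (i1, j) i2" if "(i1, j) \<in> V" for j
      using suffix_min_antimono[of j j1 A] False j1 A(2) sm[OF that] H[OF that]
      by (auto simp: min_def)
    then have "tree_ok H i1 i2 (D (i1, i2))"
      using A out unfolding tree_ok_def by (intro exI[of _ A]) auto
    then show ?thesis using False by (auto simp: improve_def m intro!: exI[of _ "D (i1, i2)"])
  qed
qed

text \<open>The tree may fit \<open>E\<close> or already \<open>E'\<close>. Lowering by the
  successor of \<open>v\<close> is idempotent, so both cases lead to a tree for
  \<open>E'\<close>.\<close>

lemma insert_body_correct: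
  fixes E :: "node rel" and u v :: node
  defines "E' \<equiv> insert (u, v) E"
  assumes E: "chain_dag E" and u: "u \<in> V" and uv: "\<not> reaches E v u"
    and F: "i1 \<noteq> i2 \<Longrightarrow> tree_ok E i1 i2 (D (i1, i2)) \<or> tree_ok E' i1 i2 (D (i1, i2))"
  defines "m \<equiv> (case lowest_predecessor E u i1 of
              None \<Rightarrow> finish D
            | Some j1 \<Rightarrow>
                if i1 = i2 \<or> highest_successor E v i2 = \<infinity> then finish D
                else improve FT D (i1, i2) j1 (highest_successor E v i2))"
  shows "\<exists>F'. fst m = D((i1, i2) := F') \<and> (i1 \<noteq> i2 \<longrightarrow> tree_ok E' i1 i2 F')"
    "real (snd m) \<le> 2 * T + 1"
proof -
  have "(\<exists>F'. fst m = D((i1, i2) := F') \<and> (i1 \<noteq> i2 \<longrightarrow> tree_ok E' i1 i2 F')) \<and>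
    real (snd m) \<le> 2 * T + 1"
  proof (cases "i1 = i2")
    case True
    then show ?thesis using T_nonneg
      by (auto simp: m_def split: option.split intro: exI[of _ "D (i2, i2)"])
  next
    case False
    show ?thesis
    proof (cases "lowest_predecessor E u i1 = None \<or> highest_successor E v i2 = \<infinity>")
      case True
      \<comment> \<open>Either no node of chain \<open>i1\<close> reaches \<open>u\<close>, or
        \<open>v\<close> reaches no node of chain \<open>i2\<close>; the new edge then yields no
        path between the two chains.\<close>
      then have "highest_successor E' (i1, j) i2 = highest_successor E (i1, j) i2" for j
        by (auto simp: E'_def highest_successor_insert lowest_predecessor_def split: if_splits)
      then have "tree_ok E' i1 i2 (D (i1, i2))"
        using F[OF False] by (simp add: tree_ok_def)
      moreover have "m = finish D"
        using True by (auto simp: m_def split: option.split)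
      ultimately show ?thesis using T_nonneg by (auto intro: exI[of _ "D (i1, i2)"])
    next
      case False2: False
      then obtain j1 where j1: "lowest_predecessor E u i1 = Some j1" by auto
      have m: "m = improve FT D (i1, i2) j1 (highest_successor E v i2)"
        using False False2 by (auto simp: m_def j1 simp del: not_infinity_eq)
      note pred = lowest_predecessor_SomeD[OF E u j1]
      obtain G where G: "G = E \<or> G = E'" "tree_ok G i1 i2 (D (i1, i2))"
        using F[OF False] by blast
      have "highest_successor E' (i1, j) i2 = (if j \<le> j1
          then min (highest_successor G (i1, j) i2) (highest_successor E v i2)
          else highest_successor G (i1, j) i2)" if "(i1, j) \<in> V" for j
        using G(1) pred(2)[OF that] by (auto simp: E'_def highest_successor_insert)
      from improve_correct[where D = D, OF G(2) pred(1) this] show ?thesis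
        unfolding m by blast
    qed
  qed
  then show "\<exists>F'. fst m = D((i1, i2) := F') \<and> (i1 \<noteq> i2 \<longrightarrow> tree_ok E' i1 i2 F')"
    "real (snd m) \<le> 2 * T + 1" by blast+
qed

text \<open>Loop invariant: a tree not yet fit for \<open>E'\<close> is still fit for
  \<open>E\<close> and its pair is pending in \<open>ps\<close>. An iteration costs
  \<open>T + 1\<close> for each of the two readings and \<open>2 * T + 1\<close> for the body,
  together \<open>4 * T + 3\<close>.\<close>

lemma insert_loop_correct:
  fixes E :: "node rel" and u v :: node
  defines "E' \<equiv> insert (u, v) E"
  assumes E: "chain_dag E" and u: "u \<in> V" and v: "v \<in> V" and uv: "\<not> reaches E v u"
    and "set ps \<subseteq> {1..k} \<times> {1..k}"
    and "\<And>i1 i2. i1 \<in> {1..k} \<Longrightarrow> i2 \<in> {1..k} \<Longrightarrow> i1 \<noteq> i2 \<Longrightarrow>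
      tree_ok E' i1 i2 (D (i1, i2)) \<or> (i1, i2) \<in> set ps \<and> tree_ok E i1 i2 (D (i1, i2))"
  shows "trees_ok E' (fst (insert_loop FT u v ps D)) \<and>
    real (snd (insert_loop FT u v ps D)) \<le> real (length ps) * (4 * T + 3) + 1"
  using assms(6,7)
proof (induction ps arbitrary: D)
  case Nil
  then show ?case by (auto simp: trees_ok_def)
next
  case (Cons p ps)
  obtain i1 i2 where p: "p = (i1, i2)" by (cases p)
  then have i: "i1 \<in> {1..k}" "i2 \<in> {1..k}" using Cons.prems(1) by auto
  have E': "chain_dag E'" unfolding E'_def using E u v uv by (rule chain_dag_insert)
  have chain: "fst u \<in> {1..k}" "fst v \<in> {1..k}"
    using V_bounds(1)[of "fst u" "snd u"] V_bounds(1)[of "fst v" "snd v"] u v by auto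
  have ok: "tree_ok E a b (D (a, b)) \<or> tree_ok E' a b (D (a, b))"
    if "a \<in> {1..k}" "b \<in> {1..k}" "a \<noteq> b" for a b
    using Cons.prems(2)[OF that] by blast
  \<comment> \<open>Whichever edge relation the tree fits, the answer is the same, as the insertion
    leaves the predecessors of \<open>u\<close> unchanged.\<close>
  have pred: "fst (ds_predecessor FT D u i1) = lowest_predecessor E u i1"
    "real (snd (ds_predecessor FT D u i1)) \<le> T + 1"
    using ok[OF i(1) chain(1)] ds_predecessor_correct[OF E u, of i1 D]
      ds_predecessor_correct[OF E' u, of i1 D] lowest_predecessor_insert_source[OF uv, of i1]
    unfolding E'_def by metis+
  have succ: "fst (ds_successor FT D v i2) = highest_successor E v i2"
    "real (snd (ds_successor FT D v i2)) \<le> T + 1"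
    using ok[OF chain(2) i(2)] ds_successor_correct[OF E v, of i2 D]
      ds_successor_correct[OF E' v, of i2 D] highest_successor_insert_target[OF uv, of i2]
    unfolding E'_def by metis+
  define m where "m = (case lowest_predecessor E u i1 of
              None \<Rightarrow> finish D
            | Some j1 \<Rightarrow>
                if i1 = i2 \<or> highest_successor E v i2 = \<infinity> then finish D
                else improve FT D (i1, i2) j1 (highest_successor E v i2))"
  obtain F' where F': "fst m = D((i1, i2) := F')" "i1 \<noteq> i2 \<Longrightarrow> tree_ok E' i1 i2 F'"
    and time: "real (snd m) \<le> 2 * T + 1"
    using insert_body_correct[OF E u uv, of i1 i2 D] ok[OF i]
    unfolding m_def E'_def by blast
  have "trees_ok E' (fst (insert_loop FT u v ps (fst m))) \<and>
    real (snd (insert_loop FT u v ps (fst m))) \<le> real (length ps) * (4 * T + 3) + 1"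
  proof (rule Cons.IH)
    show "set ps \<subseteq> {1..k} \<times> {1..k}" using Cons.prems(1) by simp
    show "tree_ok E' a b (fst m (a, b)) \<or> (a, b) \<in> set ps \<and> tree_ok E a b (fst m (a, b))"
      if "a \<in> {1..k}" "b \<in> {1..k}" "a \<noteq> b" for a b
      using Cons.prems(2)[OF that] F' that(3) by (auto simp: p)
  qed
  moreover have "fst (insert_loop FT u v (p # ps) D) = fst (insert_loop FT u v ps (fst m))"
    "snd (insert_loop FT u v (p # ps) D) =
      snd (ds_predecessor FT D u i1) + (snd (ds_successor FT D v i2) +
        (snd m + snd (insert_loop FT u v ps (fst m))))"
    by (simp_all add: p m_def pred(1) succ(1) cong: option.case_cong if_cong)
  ultimately show ?case
    using pred(2) succ(2) time by (simp add: algebra_simps)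
qed

section \<open>Single operations and sequences\<close>

text \<open>The product pays for the \<open>k\<^sup>2\<close> iterations of an insertion. The rest
  pays for a query, with one tree reading and three charges, and covers the two final charges of an
  insertion.\<close>

definition time_bound :: real where
  "time_bound = real (k\<^sup>2) * (4 * T + 3) + T + 3"

lemma ds_step_correct:
  assumes E: "chain_dag E" and D: "trees_ok E D" and legal: "legal k V E x"
  obtains D' c where "ds_step FT k D x = ((D', correct_answer E x), c)"
    "real c \<le> time_bound" "chain_dag (edges_after E x)" "trees_ok (edges_after E x) D'"
proof -
  have pos: "0 \<le> real (k\<^sup>2) * (4 * T + 3)" using T_nonneg by simp
  have ok: "tree_ok E i1 i2 (D (i1, i2))" if "i1 \<in> {1..k}" "i2 \<in> {1..k}" "i1 \<noteq> i2" for i1 i2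
    using D that by (simp add: trees_ok_def)
  have chain: "fst u \<in> {1..k}" if "u \<in> V" for u
    using V_bounds(1)[of "fst u" "snd u"] that by simp
  have succ: "fst (ds_successor FT D u i) = highest_successor E u i"
    "real (snd (ds_successor FT D u i)) \<le> T + 1" if "u \<in> V" "i \<in> {1..k}" for u i
    using ds_successor_correct[OF E that(1)] ok[OF chain[OF that(1)] that(2)] by blast+
  have "snd (fst (ds_step FT k D x)) = correct_answer E x \<and>
    real (snd (ds_step FT k D x)) \<le> time_bound \<and> chain_dag (edges_after E x) \<and>
    trees_ok (edges_after E x) (fst (fst (ds_step FT k D x)))"
  proof (cases x)
    case (Insert u v)
    then show ?thesis
      using insert_loop_correct[OF E, of u v "chain_pairs k" D] chain_dag_insert[OF E, of u v]
        legal ok T_nonneg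
      by (auto simp: ds_insert_def set_chain_pairs length_chain_pairs time_bound_def)
  next
    case (Query u v)
    then show ?thesis
      using legal succ[of u "fst v"] chain[of v] E D pos
        highest_successor_le_node_iff[OF E, of u "fst v" "snd v"]
      by (auto simp: ds_query_def time_bound_def)
  next
    case (Successor u i)
    then show ?thesis
      using legal succ[of u i] E D pos by (auto simp: time_bound_def)
  next
    case (Predecessor u i)
    with legal have u: "u \<in> V" "i \<in> {1..k}" by simp_all
    have "fst u \<noteq> i \<Longrightarrow> tree_ok E i (fst u) (D (i, fst u))"
      using ok[OF u(2) chain[OF u(1)]] by blast
    from ds_predecessor_correct[where D = D, OF E u(1) this] show ?thesis
      using Predecessor E D pos by (auto simp: time_bound_def)
  qed
  then show thesis using that by (metis prod.collapse)
qed

lemma ds_run_correct: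
  assumes "chain_dag E" "trees_ok E D" "legal_sequence k V E \<Sigma>"
  shows "map fst (ds_run FT k D \<Sigma>) = correct_answers E \<Sigma> \<and>
    (\<forall>(a, t) \<in> set (ds_run FT k D \<Sigma>). real t \<le> time_bound)"
  using assms
proof (induction \<Sigma> arbitrary: E D)
  case (Cons x xs)
  have "legal k V E x" using Cons.prems(3) by simp
  from ds_step_correct[OF Cons.prems(1,2) this]
  obtain D' c where "ds_step FT k D x = ((D', correct_answer E x), c)"
    "real c \<le> time_bound" "chain_dag (edges_after E x)" "trees_ok (edges_after E x) D'" .
  then show ?case
    using Cons.IH[of "edges_after E x" D'] Cons.prems(3) by auto
qed simp

lemma ds_init_correct:
  assumes rep: "chain_representation k n V E Out" and inv: "reachability_invariant k V E Out"
  shows "trees_ok E (fst (ds_init FT k Out))"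
  unfolding trees_ok_def
proof (intro ballI impI)
  fix i1 i2 assume i: "i1 \<in> {1..k}" "i2 \<in> {1..k}" "i1 \<noteq> i2"
  have Out: "length (Out (i1, i2)) = n" "set (Out (i1, i2)) \<subseteq> insert \<infinity> (enat ` {1..n})"
    "\<And>j1 j2. j1 \<in> {1..n} \<Longrightarrow> j2 \<in> {1..n} \<Longrightarrow>
       Out (i1, i2) ! (j1 - 1) = enat j2 \<longleftrightarrow> ((i1, j1), (i2, j2)) \<in> E"
    and EV: "E \<subseteq> V \<times> V"
    using rep i unfolding chain_representation_def by blast+
  \<comment> \<open>A finite entry would be an edge leaving a node outside \<open>V\<close>.\<close>
  have "Out (i1, i2) ! (j - 1) = \<infinity>" if j: "j \<in> {1..n}" "(i1, j) \<notin> V" for j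
  proof -
    have "Out (i1, i2) ! (j - 1) \<in> set (Out (i1, i2))"
      using j Out(1) by (intro nth_mem) auto
    then show ?thesis using Out(2) Out(3)[OF j(1)] EV j(2) by blast
  qed
  moreover have "stores (fst (ft_init FT (Out (i1, i2)))) (Out (i1, i2))"
    using correct by (simp add: fenwick_correct_def)
  ultimately have "tree_ok E i1 i2 (fst (ft_init FT (Out (i1, i2))))"
    using Out(1) inv i unfolding tree_ok_def reachability_invariant_def by blast
  then show "tree_ok E i1 i2 (fst (ds_init FT k Out) (i1, i2))"
    using i by (simp add: ds_init_def init_loop_correct set_chain_pairs)
qed

end

section \<open>Asymptotic bounds\<close>

text \<open>Eventually \<open>f\<close> is at least 1, so the absolute value of \<open>c\<close>
  serves as the factor. This absorbs the additive constants of the time bounds.\<close>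

lemma const_bigo:
  fixes f :: "nat \<Rightarrow> real"
  assumes "filterlim f at_top sequentially"
  shows "(\<lambda>_. c) \<in> O(f)"
proof (rule bigoI)
  have "eventually (\<lambda>n. 1 \<le> f n) sequentially"
    using assms by (simp add: filterlim_at_top)
  then show "eventually (\<lambda>n. norm c \<le> norm c * norm (f n)) sequentially"
    by eventually_elim (simp add: mult_le_cancel_left1)
qed

theorem lemmaA1:
  fixes FT :: "'f fenwick" and k :: nat
  assumes "fenwick_tree FT"
  shows "\<exists>f g :: nat \<Rightarrow> real. f \<in> O(\<lambda>n. real n) \<and> g \<in> O(\<lambda>n. ln (real n)) \<and>
    (\<forall>(n :: nat) V E Out \<Sigma>.
       acyclic E \<and> width V E = k \<and> chain_representation k n V E Out \<and>
       reachability_invariant k V E Out \<and> legal_sequence k V E \<Sigma> \<longrightarrow>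
       (let (D, c) = ds_init FT k Out; run = ds_run FT k D \<Sigma> in
          map fst run = correct_answers E \<Sigma> \<and>
          real c \<le> f n \<and>
          (\<forall>(a, t) \<in> set run. real t \<le> g n)))"
proof -
  obtain stores p q where correct: "fenwick_correct FT stores"
    and p: "p \<in> O(\<lambda>n. real n)" and q: "q \<in> O(\<lambda>n. ln (real n))"
    and init: "\<And>A. real (snd (ft_init FT A)) \<le> p (length A)"
    and upd: "\<And>F A i x. stores F A \<Longrightarrow> i \<in> {1..length A} \<Longrightarrow>
      real (snd (ft_update FT F i x)) \<le> q (length A)"
    and mn: "\<And>F A i. stores F A \<Longrightarrow> i \<in> {1..length A} \<Longrightarrow>
      real (snd (ft_min FT F i)) \<le> q (length A)"
    and arg: "\<And>F A i. stores F A \<Longrightarrow> real (snd (ft_argleq FT F i)) \<le> q (length A)"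
    using assms unfolding fenwick_tree_def fenwick_fast_def by blast
  \<comment> \<open>These are the bounds of \<open>init_loop_time\<close> and
    \<open>time_bound\<close> for fixed \<open>k\<close>. The absolute values supply the
    nonnegativity required there without affecting the growth.\<close>
  define f where "f n = real (k\<^sup>2) * (\<bar>p n\<bar> + 1) + 1" for n
  define g where "g n = real (k\<^sup>2) * (4 * \<bar>q n\<bar> + 3) + \<bar>q n\<bar> + 3" for n
  note lin = const_bigo[OF filterlim_real_sequentially]
    and log = const_bigo[OF filterlim_compose[OF ln_at_top filterlim_real_sequentially]]
  have f: "f \<in> O(\<lambda>n. real n)"
    unfolding f_def using p lin by (intro sum_in_bigo) (auto intro!: sum_in_bigo)
  have g: "g \<in> O(\<lambda>n. ln (real n))"
    unfolding g_def using q log by (intro sum_in_bigo) (auto intro!: sum_in_bigo)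
  have "map fst (ds_run FT k (fst (ds_init FT k Out)) \<Sigma>) = correct_answers E \<Sigma> \<and>
      real (snd (ds_init FT k Out)) \<le> f n \<and>
      (\<forall>(a, t) \<in> set (ds_run FT k (fst (ds_init FT k Out)) \<Sigma>). real t \<le> g n)"
    if E: "acyclic E" and rep: "chain_representation k n V E Out"
      and inv: "reachability_invariant k V E Out" and legal: "legal_sequence k V E \<Sigma>"
    for n V E Out \<Sigma>
  proof -
    interpret ds_chains k n V FT stores "\<bar>q n\<bar>"
      using rep correct upd mn arg
      by unfold_locales (auto simp: chain_representation_def intro: order_trans[OF _ abs_ge_self])
    have "chain_dag E" using E rep by (auto simp: chain_dag_def chain_representation_def)
    from ds_run_correct[OF this ds_init_correct[OF rep inv] legal]
    have run: "map fst (ds_run FT k (fst (ds_init FT k Out)) \<Sigma>) = correct_answers E \<Sigma>"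
      "\<forall>(a, t) \<in> set (ds_run FT k (fst (ds_init FT k Out)) \<Sigma>). real t \<le> g n"
      by (simp_all add: time_bound_def g_def)
    have "real (snd (ft_init FT (Out (i1, i2)))) \<le> \<bar>p n\<bar>"
      if "(i1, i2) \<in> set (chain_pairs k)" "i1 \<noteq> i2" for i1 i2
    proof -
      have "length (Out (i1, i2)) = n"
        using rep that by (auto simp: chain_representation_def set_chain_pairs)
      then show ?thesis using init[of "Out (i1, i2)"] by auto
    qed
    from init_loop_time[where ps = "chain_pairs k" and Out = Out and FT = FT, OF this abs_ge_zero] have "real (snd (ds_init FT k Out)) \<le> f n"
      by (simp add: ds_init_def f_def length_chain_pairs)
    with run show ?thesis by blast
  qed
  with f g show ?thesis
    unfolding Let_def case_prod_unfold by blast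
qed

end
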